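(* Let $\Sigma$ be a finite alphabet, let $u,v\in\Sigma^\star$ and $n\in\mathbb{N}$. If $u\equiv^2_{|\Sigma|+1,n}v$, then $u\equiv^2_n v$.
   Context: Words are finite structures with universe $\{1,\dots,|w|\}$, unary predicates $Q_a$ ($a\in\Sigma$) marking the positions carrying $a$, and the order $<$. $\mathrm{FO}^2_n[<]$ is first-order logic over this signature using only the two variables $x,y$, with quantifier depth at most $n$; $\mathrm{FO}^2_{m,n}[<]$ is the set of formulas of $\mathrm{FO}^2_n[<]$ in which every path in the parse tree has at most $m$ blocks of alternating quantifiers. $u\equiv^2_n v$ (resp. $u\equiv^2_{m,n}v$) means $u$ and $v$ satisfy the same sentences of $\mathrm{FO}^2_n[<]$ (resp. $\mathrm{FO}^2_{m,n}[<]$). *)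

theory Defs
  imports Main
begin

datatype var = X | Y

datatype 'a fo2 =
    TT
  | FF
  | Q 'a var
  | Less var var
  | Neg "'a fo2"
  | Conj "'a fo2" "'a fo2"
  | Disj "'a fo2" "'a fo2"
  | Ex var "'a fo2"
  | All var "'a fo2"

text \<open>Semantics: a word w has universe {1..|w|}; position i carries letter w!(i-1).\<close>
fun sat :: "'a list \<Rightarrow> (var \<Rightarrow> nat) \<Rightarrow> 'a fo2 \<Rightarrow> bool" where
  "sat w s TT = True"
| "sat w s FF = False"
| "sat w s (Q a z) = (w ! (s z - 1) = a)"
| "sat w s (Less z z') = (s z < s z')"
| "sat w s (Neg \<phi>) = (\<not> sat w s \<phi>)"
| "sat w s (Conj \<phi> \<psi>) = (sat w s \<phi> \<and> sat w s \<psi>)"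
| "sat w s (Disj \<phi> \<psi>) = (sat w s \<phi> \<or> sat w s \<psi>)"
| "sat w s (Ex z \<phi>) = (\<exists>i\<in>{1..length w}. sat w (s(z := i)) \<phi>)"
| "sat w s (All z \<phi>) = (\<forall>i\<in>{1..length w}. sat w (s(z := i)) \<phi>)"

fun free :: "'a fo2 \<Rightarrow> var set" where
  "free TT = {}"
| "free FF = {}"
| "free (Q a z) = {z}"
| "free (Less z z') = {z, z'}"
| "free (Neg \<phi>) = free \<phi>"
| "free (Conj \<phi> \<psi>) = free \<phi> \<union> free \<psi>"
| "free (Disj \<phi> \<psi>) = free \<phi> \<union> free \<psi>"
| "free (Ex z \<phi>) = free \<phi> - {z}"
| "free (All z \<phi>) = free \<phi> - {z}"

definition sentence :: "'a fo2 \<Rightarrow> bool" where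
  "sentence \<phi> \<longleftrightarrow> free \<phi> = {}"

text \<open>Satisfaction of a sentence (the assignment is irrelevant for sentences).\<close>
definition models :: "'a list \<Rightarrow> 'a fo2 \<Rightarrow> bool" where
  "models w \<phi> \<longleftrightarrow> sat w (\<lambda>_. 1) \<phi>"

fun qdepth :: "'a fo2 \<Rightarrow> nat" where
  "qdepth TT = 0"
| "qdepth FF = 0"
| "qdepth (Q a z) = 0"
| "qdepth (Less z z') = 0"
| "qdepth (Neg \<phi>) = qdepth \<phi>"
| "qdepth (Conj \<phi> \<psi>) = max (qdepth \<phi>) (qdepth \<psi>)"
| "qdepth (Disj \<phi> \<psi>) = max (qdepth \<phi>) (qdepth \<psi>)"
| "qdepth (Ex z \<phi>) = Suc (qdepth \<phi>)"
| "qdepth (All z \<phi>) = Suc (qdepth \<phi>)"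

text \<open>Maximal number of blocks of alternating quantifiers along a path of the parse tree.
  Negations are taken into account via the polarity p (True = positive): an existential
  quantifier under positive polarity (or a universal one under negative polarity) is
  effectively existential (kind True), otherwise effectively universal (kind False).
  c is the kind of the current (innermost enclosing) block, None if there is none.\<close>
fun blocks :: "bool \<Rightarrow> bool option \<Rightarrow> 'a fo2 \<Rightarrow> nat" where
  "blocks p c TT = 0"
| "blocks p c FF = 0"
| "blocks p c (Q a z) = 0"
| "blocks p c (Less z z') = 0"
| "blocks p c (Neg \<phi>) = blocks (\<not> p) c \<phi>"
| "blocks p c (Conj \<phi> \<psi>) = max (blocks p c \<phi>) (blocks p c \<psi>)"
| "blocks p c (Disj \<phi> \<psi>) = max (blocks p c \<phi>) (blocks p c \<psi>)"
| "blocks p c (Ex z \<phi>) =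
     (if c = Some p then blocks p c \<phi> else Suc (blocks p (Some p) \<phi>))"
| "blocks p c (All z \<phi>) =
     (if c = Some (\<not> p) then blocks p c \<phi> else Suc (blocks p (Some (\<not> p)) \<phi>))"

definition alt_blocks :: "'a fo2 \<Rightarrow> nat" where
  "alt_blocks \<phi> = blocks True None \<phi>"

definition fo2_equiv :: "nat \<Rightarrow> 'a list \<Rightarrow> 'a list \<Rightarrow> bool" where
  "fo2_equiv n u v \<longleftrightarrow>
     (\<forall>\<phi>. sentence \<phi> \<and> qdepth \<phi> \<le> n \<longrightarrow> (models u \<phi> \<longleftrightarrow> models v \<phi>))"

definition fo2_alt_equiv :: "nat \<Rightarrow> nat \<Rightarrow> 'a list \<Rightarrow> 'a list \<Rightarrow> bool" where
  "fo2_alt_equiv m n u v \<longleftrightarrow>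
     (\<forall>\<phi>. sentence \<phi> \<and> qdepth \<phi> \<le> n \<and> alt_blocks \<phi> \<le> m \<longrightarrow>
        (models u \<phi> \<longleftrightarrow> models v \<phi>))"

end

theory Submission
  imports Defs
begin

text \<open>A ranker is a sequence of instructions ``go to the next \<open>a\<close> to the right'' or ``to the left''
  (Weis and Immerman). If all rankers of length at most \<open>n\<close> are defined on the same of the two
  words and are ordered alike (length \<open>n\<close> against length \<open>n - 1\<close>), Duplicator wins the \<open>n\<close>-round
  two-pebble game, by playing relative to the ranker positions around Spoiler's pebble. A ranker
  with \<open>m\<close> changes of direction needs only \<open>m + 1\<close> quantifier blocks, and a shortest ranker
  reaching a position has at most \<open>|\<Sigma>|\<close> monotone blocks: after each turn it is confined to an
  interval from which one more letter is missing, since leaving the interval would have made an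
  earlier move unnecessary. One more block is spent on comparing two rankers.\<close>

section \<open>Order of positions relative to a direction, so that mirror-image arguments are made
  once\<close>

definition dlt :: "bool \<Rightarrow> nat \<Rightarrow> nat \<Rightarrow> bool" where
  "dlt d x y \<longleftrightarrow> (if d then x < y else y < x)"

lemma dlt_not [simp]: "dlt (\<not> d) x y = dlt d y x"
  by (simp add: dlt_def)

lemma dlt_irrefl [simp]: "\<not> dlt d x x"
  by (simp add: dlt_def)

lemma dlt_trans: "dlt d x y \<Longrightarrow> dlt d y z \<Longrightarrow> dlt d x z"
  by (auto simp: dlt_def split: if_splits)

lemma dlt_asym: "dlt d x y \<Longrightarrow> \<not> dlt d y x"
  by (auto simp: dlt_def split: if_splits)

lemma dlt_le_trans: "\<not> dlt d y x \<Longrightarrow> dlt d y z \<Longrightarrow> dlt d x z"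
  by (auto simp: dlt_def split: if_splits)

lemma dlt_trans_le: "dlt d x y \<Longrightarrow> \<not> dlt d z y \<Longrightarrow> dlt d x z"
  by (auto simp: dlt_def split: if_splits)

lemma dlt_linear: "dlt d x y \<or> x = y \<or> dlt d y x"
  by (auto simp: dlt_def)

lemma finite_has_nearest:
  assumes "finite A" "A \<noteq> {}"
  obtains p where "p \<in> A" "\<And>q. q \<in> A \<Longrightarrow> \<not> dlt d q p"
proof (cases d)
  case True
  then show ?thesis using assms that[of "Min A"] by (auto simp: dlt_def)
next
  case False
  then show ?thesis using assms that[of "Max A"] by (auto simp: dlt_def)
qed


section \<open>Rankers\<close>

text \<open>A ranker is stored with its latest instruction first. The instruction \<open>(True, a)\<close> moves to
  the next \<open>a\<close> on the right, \<open>(False, a)\<close> to the next \<open>a\<close> on the left. The direction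
  argument of \<open>rpos\<close> matters only for the empty ranker, which denotes the position before the
  word when the next move goes right and the position after it when the next move goes left.\<close>

type_synonym 'a ranker = "(bool \<times> 'a) list"

fun rpos :: "'a list \<Rightarrow> bool \<Rightarrow> 'a ranker \<Rightarrow> nat \<Rightarrow> bool" where
  "rpos w d [] p \<longleftrightarrow> p = (if d then 0 else Suc (length w))"
| "rpos w d ((e, a) # r) p \<longleftrightarrow>
     p \<in> {1..length w} \<and> w ! (p - 1) = a \<and> (\<exists>q. rpos w e r q \<and> dlt e q p) \<and>
     (\<forall>p'. p' \<in> {1..length w} \<and> w ! (p' - 1) = a \<and> (\<exists>q. rpos w e r q \<and> dlt e q p') \<longrightarrow>
        \<not> dlt e p' p)"

definition beyond :: "'a list \<Rightarrow> bool \<Rightarrow> 'a ranker \<Rightarrow> nat \<Rightarrow> bool" where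
  "beyond w d r p \<longleftrightarrow> (\<exists>q. rpos w d r q \<and> dlt d q p)"

definition cand :: "'a list \<Rightarrow> bool \<Rightarrow> 'a \<Rightarrow> 'a ranker \<Rightarrow> nat \<Rightarrow> bool" where
  "cand w e a r p \<longleftrightarrow> p \<in> {1..length w} \<and> w ! (p - 1) = a \<and> beyond w e r p"

lemma rpos_Cons:
  "rpos w d ((e, a) # r) p \<longleftrightarrow> cand w e a r p \<and> (\<forall>q. cand w e a r q \<longrightarrow> \<not> dlt e q p)"
  by (auto simp: cand_def beyond_def)

declare rpos.simps(2) [simp del]

lemma rpos_dir: "r \<noteq> [] \<Longrightarrow> rpos w d r = rpos w d' r"
  by (cases r) (auto simp: rpos_Cons fun_eq_iff)

lemma rpos_unique: "rpos w d r p \<Longrightarrow> rpos w d r q \<Longrightarrow> p = q"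
  by (cases r) (auto simp: rpos_Cons, metis dlt_linear)

lemma rpos_eqI: "rpos w d r x \<Longrightarrow> rpos w d r' x \<Longrightarrow> rpos w d r = rpos w d r'"
  by (auto simp: fun_eq_iff dest: rpos_unique)

lemma rpos_bound: "rpos w d r p \<Longrightarrow> p \<le> Suc (length w)"
  by (cases r) (auto simp: rpos_Cons cand_def split: if_splits)

lemma beyond_rpos: "rpos w d r q \<Longrightarrow> beyond w d r p \<longleftrightarrow> dlt d q p"
  unfolding beyond_def using rpos_unique by metis

lemma finite_cand: "finite {p. cand w e a r p}"
  by (rule finite_subset[of _ "{1..length w}"]) (auto simp: cand_def)

lemma rpos_Cons_ex: "(\<exists>p. rpos w d ((e, a) # r) p) \<longleftrightarrow> (\<exists>p. cand w e a r p)"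
proof
  assume "\<exists>p. cand w e a r p"
  then have "{p. cand w e a r p} \<noteq> {}" by blast
  from finite_has_nearest[OF finite_cand this, of e] obtain p
    where "p \<in> {p. cand w e a r p}" "\<And>q. q \<in> {p. cand w e a r p} \<Longrightarrow> \<not> dlt e q p" by blast
  then show "\<exists>p. rpos w d ((e, a) # r) p" by (auto simp: rpos_Cons)
qed (auto simp: rpos_Cons)

lemma cand_rpos: "cand w e a r p \<Longrightarrow> \<exists>t. rpos w d ((e, a) # r) t \<and> \<not> dlt e p t"
  using rpos_Cons_ex[of w d e a r] by (auto simp: rpos_Cons)

lemma rpos_ConsD:
  assumes "rpos w d ((e, a) # r) p"
  obtains q where "p \<in> {1..length w}" "w ! (p - 1) = a" "rpos w e r q" "dlt e q p"
  using assms by (auto simp: rpos_Cons cand_def beyond_def)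

lemma rpos_Cons_cong:
  assumes "\<And>d. rpos w d r = rpos w d r'"
  shows "rpos w d (h # r) = rpos w d (h # r')"
  using assms by (cases h) (simp add: rpos_Cons cand_def beyond_def fun_eq_iff)

text \<open>The number of maximal runs of moves in one direction: turns plus one, but 0 for the
  empty ranker.\<close>

fun alt :: "'a ranker \<Rightarrow> nat" where
  "alt [] = 0"
| "alt [x] = 1"
| "alt (x # y # r) = (if fst x = fst y then 0 else 1) + alt (y # r)"

lemma alt_Cons: "alt (x # r) = (if r \<noteq> [] \<and> fst (hd r) = fst x then 0 else 1) + alt r"
  by (cases r) auto

lemma alt_pos: "r \<noteq> [] \<Longrightarrow> 0 < alt r"
  by (induction r) (auto simp: alt_Cons)


section \<open>Rankers in two-variable logic\<close>

fun other :: "var \<Rightarrow> var" where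
  "other X = Y"
| "other Y = X"

lemma other_neq [simp]: "other z \<noteq> z" "z \<noteq> other z"
  by (cases z; simp)+

definition dless :: "bool \<Rightarrow> var \<Rightarrow> var \<Rightarrow> 'a fo2" where
  "dless d z z' = (if d then Less z z' else Less z' z)"

lemma sat_dless [simp]: "sat w s (dless d z z') \<longleftrightarrow> dlt d (s z) (s z')"
  by (simp add: dless_def dlt_def)

lemma qdepth_dless [simp]: "qdepth (dless d z z') = 0"
  by (simp add: dless_def)

lemma blocks_dless [simp]: "blocks p c (dless d z z') = 0"
  by (simp add: dless_def)

lemma free_dless [simp]: "free (dless d z z') = {z, z'}"
  by (auto simp: dless_def)

text \<open>If the last move of \<open>r\<close> goes in direction \<open>e\<close>, being beyond \<open>r\<close> in direction \<open>e\<close> is an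
  existential property; otherwise it is the negation of being at \<open>r\<close> or beyond it in the
  opposite direction. So only the turns of \<open>r\<close> cost quantifier alternations.\<close>

fun bey :: "bool \<Rightarrow> 'a ranker \<Rightarrow> var \<Rightarrow> 'a fo2" where
  "bey e [] z = TT"
| "bey e ((d, a) # r) z =
     (let \<phi> = Ex (other z) (Conj (Q a (other z)) (Conj (dless d (other z) z) (bey d r (other z))))
      in if d = e then \<phi> else Neg (Disj (Conj (Q a z) (bey d r z)) \<phi>))"

lemma qdepth_bey: "qdepth (bey e r z) \<le> length r"
  by (induction e r z rule: bey.induct) (auto simp: Let_def intro: le_SucI)

lemma free_bey: "free (bey e r z) \<subseteq> {z}"
  by (induction e r z rule: bey.induct) (auto simp: Let_def)

text \<open>The quantifier of the last move has kind \<open>(fst (hd r) = e) = p\<close>, as the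
  negation appears exactly when that move does not go in direction \<open>e\<close>. A current block
  of this kind absorbs it, which saves one block.\<close>

lemma blocks_bey:
  "blocks p c (bey e r z) \<le> alt r - (if r \<noteq> [] \<and> c = Some ((fst (hd r) = e) = p) then 1 else 0)"
proof (induction r arbitrary: p c e z)
  case Nil
  then show ?case by simp
next
  case (Cons h r)
  obtain d a where h: "h = (d, a)" by (cases h)
  \<comment> \<open>Either the move before also goes in direction \<open>d\<close> and its
    quantifier joins the block, or there is a turn and \<open>alt r\<close> is already smaller by
    one.\<close>
  have small: "blocks q (Some q) (bey d r y) \<le> alt (h # r) - 1" for q y
    using Cons[of q "Some q" d y] alt_pos[of r] by (cases "r = []") (auto simp: alt_Cons h)
  have big: "blocks q c (bey d r y) \<le> alt (h # r)" for q y
    using Cons[of q c d y] by (auto simp: alt_Cons split: if_splits)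
  have pos: "0 < alt (h # r)" by (simp add: alt_pos)
  show ?case
    using small[of p "other z"] small[of "\<not> p" "other z"] small[of "\<not> p" z] big[of "\<not> p" z] pos
    by (auto simp: Let_def h)
qed

text \<open>Definedness makes the negated form correct: once \<open>r\<close> has a position, not
  being at or past it in one direction means lying strictly beyond it in the other.\<close>

lemma sat_bey:
  assumes "rpos w d0 r p" and "s z \<in> {1..length w}"
  shows "sat w s (bey e r z) \<longleftrightarrow> beyond w e r (s z)"
  using assms
proof (induction r arbitrary: d0 p s e z)
  case Nil
  then show ?case by (auto simp: beyond_def dlt_def)
next
  case (Cons h r)
  obtain d a where h: "h = (d, a)" by (cases h)
  from Cons.prems(1)[unfolded h] obtain q where q: "rpos w d r q" by (rule rpos_ConsD)
  note p = rpos_dir[THEN fun_cong, THEN iffD1, OF _ Cons.prems(1)[unfolded h], simplified]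
  let ?\<phi> = "Ex (other z) (Conj (Q a (other z)) (Conj (dless d (other z) z) (bey d r (other z))))"
  have IH: "sat w (s(other z := i)) (bey d r (other z)) \<longleftrightarrow> beyond w d r i"
    if "i \<in> {1..length w}" for i
    using Cons.IH[OF q, of "s(other z := i)" "other z" d] that by (simp add: fun_upd_def)
  have "sat w s ?\<phi> \<longleftrightarrow> (\<exists>i. cand w d a r i \<and> dlt d i (s z))"
    using IH by (auto simp: cand_def simp del: fun_upd_apply) (auto simp: IH)
  also have "\<dots> \<longleftrightarrow> beyond w d ((d, a) # r) (s z)"
    using p[of d] by (metis beyond_rpos dlt_le_trans rpos_Cons)
  finally have \<phi>: "sat w s ?\<phi> \<longleftrightarrow> beyond w d ((d, a) # r) (s z)" .
  show ?case
  proof (cases "d = e")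
    case True
    then show ?thesis using \<phi> by (simp add: Let_def h)
  next
    case False
    then have e: "e = (\<not> d)" by auto
    have "sat w s (bey e ((d, a) # r) z) \<longleftrightarrow> \<not> (cand w d a r (s z) \<or> dlt d p (s z))"
      using False \<phi> Cons.IH[OF q, of s z d] Cons.prems(2) beyond_rpos[OF p[of d]]
      by (auto simp: Let_def cand_def)
    also have "\<dots> \<longleftrightarrow> dlt d (s z) p"
      using p[of d] by (metis dlt_asym dlt_linear rpos_Cons)
    also have "\<dots> \<longleftrightarrow> beyond w e ((d, a) # r) (s z)"
      using beyond_rpos[OF p[of e]] e by simp
    finally show ?thesis by (simp add: h)
  qed
qed

text \<open>The choice made by the last move is exposed to \<open>\<chi>\<close>: \<open>TT\<close>
  then tests definedness, a \<open>bey\<close> formula compares with another ranker.\<close>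

definition ranker_test :: "bool \<Rightarrow> 'a \<Rightarrow> 'a ranker \<Rightarrow> 'a fo2 \<Rightarrow> 'a fo2" where
  "ranker_test d a r \<chi> = Ex X (Conj (Q a X) (Conj (bey d r X) \<chi>))"

lemma models_ranker_test:
  assumes "rpos w d' r p"
  shows "models w (ranker_test d a r \<chi>) \<longleftrightarrow> (\<exists>x. cand w d a r x \<and> sat w ((\<lambda>_. 1)(X := x)) \<chi>)"
  using sat_bey[OF assms, of "(\<lambda>_. 1)(X := x)" X d for x]
  by (auto simp: models_def ranker_test_def cand_def)

text \<open>The strict bounds leave room for the outer \<open>Ex\<close>. The test for
  \<open>r\<close> continues its block if the last move of \<open>r\<close> goes in direction
  \<open>d\<close>, so both together need at most \<open>alt ((d, a) # r)\<close> blocks.\<close>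

lemma ranker_test_transfer:
  assumes "fo2_alt_equiv m n u v"
    and "length r < n" "alt ((d, a) # r) \<le> m"
    and "free \<chi> \<subseteq> {X}" "qdepth \<chi> < n" "blocks True (Some True) \<chi> < m"
    and "rpos u d' r p" "rpos v d' r p'"
  shows "(\<exists>x. cand u d a r x \<and> sat u ((\<lambda>_. 1)(X := x)) \<chi>) \<longleftrightarrow>
    (\<exists>x. cand v d a r x \<and> sat v ((\<lambda>_. 1)(X := x)) \<chi>)"
proof -
  have "blocks True (Some True) (bey d r X) < m"
    using assms(3) blocks_bey[of True "Some True" d r X] alt_pos[of r]
    by (cases "r = []") (auto simp: alt_Cons split: if_splits)
  then have "alt_blocks (ranker_test d a r \<chi>) \<le> m"
    using assms(6) by (simp add: alt_blocks_def ranker_test_def)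
  moreover have "qdepth (ranker_test d a r \<chi>) \<le> n"
    using assms(2,5) qdepth_bey[of d r X] by (simp add: ranker_test_def)
  moreover have "sentence (ranker_test d a r \<chi>)"
    using assms(4) free_bey[of d r X] by (auto simp: sentence_def ranker_test_def)
  ultimately have "models u (ranker_test d a r \<chi>) \<longleftrightarrow> models v (ranker_test d a r \<chi>)"
    using assms(1) by (simp add: fo2_alt_equiv_def)
  then show ?thesis
    using assms(7,8) by (simp add: models_ranker_test)
qed

lemma alt_equiv_defined:
  assumes "fo2_alt_equiv m n u v"
    and "length r < n" "alt ((d, a) # r) \<le> m"
    and "rpos u d' r p" "rpos v d' r p'"
  shows "(\<exists>x. rpos u e ((d, a) # r) x) \<longleftrightarrow> (\<exists>x. rpos v e ((d, a) # r) x)"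
proof -
  have "0 < alt ((d, a) # r)" by (rule alt_pos) simp
  then show ?thesis
    using ranker_test_transfer[OF assms(1-3) _ _ _ assms(4,5), of TT] assms(2,3)
    by (simp add: rpos_Cons_ex)
qed

text \<open>Both values of \<open>e\<close> are covered, so equality of positions is preserved as
  well.\<close>

definition same_order :: "'a list \<Rightarrow> 'a list \<Rightarrow> 'a ranker \<Rightarrow> 'a ranker \<Rightarrow> bool" where
  "same_order u v r r' \<longleftrightarrow>
     (\<forall>d d' p p' q q' e. rpos u d r p \<longrightarrow> rpos v d r p' \<longrightarrow> rpos u d' r' q \<longrightarrow> rpos v d' r' q' \<longrightarrow>
        dlt e p q = dlt e p' q')"

lemma same_orderD:
  assumes "same_order u v r r'" "rpos u d r p" "rpos v d r p'" "rpos u d' r' q" "rpos v d' r' q'"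
  shows "dlt e p q = dlt e p' q'"
  using assms unfolding same_order_def by blast

lemma same_order_swap: "same_order u v r r' \<Longrightarrow> same_order v u r r'"
  unfolding same_order_def by blast

lemma same_order_Nil:
  assumes "r = [] \<or> r' = []"
  shows "same_order u v r r'"
  using assms unfolding same_order_def
  by (cases r; cases r') (auto simp: rpos_Cons cand_def dlt_def split: if_splits)

text \<open>Among the candidates for the position of \<open>r\<close>, the ranker picks the first one in its
  direction, so it precedes (or is not after) the position of \<open>r'\<close> iff some candidate does.\<close>

lemma alt_equiv_same_order:
  assumes "fo2_alt_equiv m n u v"
    and "length r \<le> n" "alt r \<le> m" "length r' < n" "alt r' < m"
  shows "same_order u v r r'"
proof (cases "r = [] \<or> r' = []")
  case True
  then show ?thesis by (rule same_order_Nil)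
next
  case False
  then obtain d a s where r: "r = (d, a) # s" by (cases r) auto
  show ?thesis
    unfolding same_order_def
  proof (intro allI impI)
    fix d1 d2 p p' q q' e
    assume A: "rpos u d1 r p" "rpos v d1 r p'" "rpos u d2 r' q" "rpos v d2 r' q'"
    obtain y where y: "rpos u d s y" using A(1) unfolding r by (rule rpos_ConsD)
    obtain y' where y': "rpos v d s y'" using A(2) unfolding r by (rule rpos_ConsD)
    have B: "rpos u e r' q" "rpos v e r' q'" for e
      using A(3,4) False rpos_dir by metis+
    have len: "length s < n" "alt ((d, a) # s) \<le> m" using assms(2,3) r by auto
    have dep: "qdepth (bey e r' X) < n" for e
      using qdepth_bey[of e r' X] assms(4) by simp
    \<comment> \<open>In the worst case the comparison opens a new block below the outer
      \<open>Ex\<close>; hence \<open>alt r'\<close> stays strictly below \<open>m\<close>.\<close>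
    have blk: "blocks c c' (bey e r' X) < m" for c c' e
      using blocks_bey[of c c' e r' X] assms(5) by simp
    have S: "sat u ((\<lambda>_. 1)(X := x)) (bey e r' X) \<longleftrightarrow> dlt e q x" if "cand u d a s x" for e x
      using sat_bey[OF A(3), of "(\<lambda>_. 1)(X := x)" X e] that beyond_rpos[OF B(1)]
      by (simp add: cand_def)
    have S': "sat v ((\<lambda>_. 1)(X := x)) (bey e r' X) \<longleftrightarrow> dlt e q' x" if "cand v d a s x" for e x
      using sat_bey[OF A(4), of "(\<lambda>_. 1)(X := x)" X e] that beyond_rpos[OF B(2)]
      by (simp add: cand_def)
    have p: "cand u d a s p" "\<And>x. cand u d a s x \<Longrightarrow> \<not> dlt d x p"
      and p': "cand v d a s p'" "\<And>x. cand v d a s x \<Longrightarrow> \<not> dlt d x p'"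
      using A(1,2) by (auto simp: r rpos_Cons)
    have "dlt d p q \<longleftrightarrow> (\<exists>x. cand u d a s x \<and> sat u ((\<lambda>_. 1)(X := x)) (bey (\<not> d) r' X))"
      using S[of _ "\<not> d"] p dlt_le_trans by (metis dlt_not)
    also have "\<dots> \<longleftrightarrow> (\<exists>x. cand v d a s x \<and> sat v ((\<lambda>_. 1)(X := x)) (bey (\<not> d) r' X))"
      by (rule ranker_test_transfer[OF assms(1) len free_bey dep blk y y'])
    also have "\<dots> \<longleftrightarrow> dlt d p' q'"
      using S'[of _ "\<not> d"] p' dlt_le_trans by (metis dlt_not)
    finally have 1: "dlt d p q \<longleftrightarrow> dlt d p' q'" .
    have "\<not> dlt d q p \<longleftrightarrow> (\<exists>x. cand u d a s x \<and> sat u ((\<lambda>_. 1)(X := x)) (Neg (bey d r' X)))"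
      using S[of _ d] p dlt_trans_le by (metis sat.simps(5))
    also have "\<dots> \<longleftrightarrow> (\<exists>x. cand v d a s x \<and> sat v ((\<lambda>_. 1)(X := x)) (Neg (bey d r' X)))"
      by (rule ranker_test_transfer[OF assms(1) len _ _ _ y y']) (auto simp: dep blk free_bey)
    also have "\<dots> \<longleftrightarrow> \<not> dlt d q' p'"
      using S'[of _ d] p' dlt_trans_le by (metis sat.simps(5))
    finally have 2: "dlt d q p \<longleftrightarrow> dlt d q' p'" by blast
    show "dlt e p q = dlt e p' q'"
      using 1 2 by (cases "e = d") (auto simp: dlt_def)
  qed
qed


section \<open>Reducing the number of turns\<close>

text \<open>\<open>base r\<close> is the part of \<open>r\<close> before the move that precedes the last turn. A ranker is tight
  if, after each turn, it stays strictly inside the stretch traversed by the move before that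
  turn. Leaving this stretch makes that move superfluous.\<close>

fun base :: "'a ranker \<Rightarrow> 'a ranker option" where
  "base [] = None"
| "base [x] = None"
| "base (x # y # r) = (if fst x = fst y then base (y # r) else Some r)"

primrec tight :: "'a list \<Rightarrow> 'a ranker \<Rightarrow> bool" where
  "tight w [] \<longleftrightarrow> True"
| "tight w (h # r) \<longleftrightarrow> tight w r \<and>
     (\<forall>q x y. base (h # r) = Some q \<longrightarrow> rpos w (\<not> fst h) (h # r) x \<longrightarrow>
        rpos w (\<not> fst h) q y \<longrightarrow> dlt (fst h) x y)"

lemma base_length: "base (x # r) = Some q \<Longrightarrow> length q < length r"
  by (induction r arbitrary: x) (auto split: if_splits intro: less_SucI)

lemma base_alt: "base (x # r) = Some q \<Longrightarrow> alt q \<le> alt r"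
proof (induction r arbitrary: x)
  case (Cons y r)
  have "alt r \<le> alt (y # r)" by (simp add: alt_Cons)
  then show ?case
    using Cons.IH[of y] Cons.prems by (auto split: if_splits)
qed simp

lemma base_defined:
  assumes "base ((e, a) # r) = Some q" "rpos w d ((e, a) # r) x"
  shows "\<exists>y. rpos w (\<not> e) q y"
  using assms
proof (induction r arbitrary: e a d x)
  case (Cons h r)
  obtain f b where h: "h = (f, b)" by (cases h)
  from Cons.prems(2) obtain t where t: "rpos w e (h # r) t" by (rule rpos_ConsD)
  show ?case
  proof (cases "e = f")
    case True
    then show ?thesis using Cons.IH[of f b] Cons.prems(1) t h by auto
  next
    case False
    then have f: "f = (\<not> e)" by auto
    from t obtain y where "rpos w f r y" unfolding h by (rule rpos_ConsD)
    then show ?thesis using Cons.prems(1) False h f by auto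
  qed
qed simp

text \<open>Each turn of a tight ranker excludes one more letter, the one the ranker stopped at, from the
  stretch in which the ranker continues.\<close>

lemma tight_avoids_letters:
  assumes "tight w ((e, c) # s)" "rpos w d ((e, c) # s) x" "rpos w e s y"
  shows "\<exists>L. finite L \<and> Suc (card L) = alt ((e, c) # s) \<and> c \<notin> L \<and>
    (\<forall>z\<in>{1..length w}. dlt e y z \<and>
       (\<forall>q g. base ((e, c) # s) = Some q \<longrightarrow> rpos w (\<not> e) q g \<longrightarrow> dlt e z g) \<longrightarrow> w ! (z - 1) \<notin> L)"
  using assms
proof (induction s arbitrary: e c d x y)
  case Nil
  show ?case by (rule exI[of _ "{}"]) simp
next
  case (Cons h s)
  obtain f b where h: "h = (f, b)" by (cases h)
  have y: "rpos w d' (h # s) y" for d'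
    using Cons.prems(3) rpos_dir by (metis list.distinct(1))
  from y obtain t where t: "rpos w f s t" "dlt f t y" "w ! (y - 1) = b" "y \<in> {1..length w}"
    unfolding h by (blast elim: rpos_ConsD)
  from Cons.prems(2) have x: "x \<in> {1..length w}" "w ! (x - 1) = c" "dlt e y x"
    using rpos_unique[OF Cons.prems(3)] by (auto elim!: rpos_ConsD)
  have x': "rpos w d' ((e, c) # h # s) x" for d'
    using Cons.prems(2) rpos_dir by (metis list.distinct(1))
  have tight_x: "dlt e x g" if "base ((e, c) # h # s) = Some q" "rpos w (\<not> e) q g" for q g
    using Cons.prems(1) that x'[of "\<not> e"] by simp
  have tight_y: "dlt f y g" if "base (h # s) = Some q" "rpos w (\<not> f) q g" for q g
    using Cons.prems(1) that y[of "\<not> f"] unfolding h by simp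
  have "tight w ((f, b) # s)" using Cons.prems(1) h by simp
  from Cons.IH[OF this y[unfolded h] t(1)] obtain L where
    L: "finite L" "Suc (card L) = alt (h # s)" "b \<notin> L"
    "\<And>z. z \<in> {1..length w} \<Longrightarrow> dlt f t z \<Longrightarrow>
       (\<And>q g. base (h # s) = Some q \<Longrightarrow> rpos w (\<not> f) q g \<Longrightarrow> dlt f z g) \<Longrightarrow> w ! (z - 1) \<notin> L"
    unfolding h by blast
  show ?case
  proof (cases "e = f")
    case True
    \<comment> \<open>Within a run the stretch only shrinks, so excluded letters stay
      excluded.\<close>
    have avoid: "w ! (z - 1) \<notin> L" if "z \<in> {1..length w}" "dlt e y z"
      "\<And>q g. base ((e, c) # h # s) = Some q \<Longrightarrow> rpos w (\<not> e) q g \<Longrightarrow> dlt e z g" for z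
      using L(4)[OF that(1)] that(2,3) dlt_trans[OF t(2)] True h by auto
    then have "c \<notin> L"
      using x tight_x by blast
    then show ?thesis using L(1,2) avoid True h by (intro exI[of _ L]) auto
  next
    case False
    then have f: "f = (\<not> e)" by auto
    \<comment> \<open>After a turn the stretch lies strictly between \<open>t\<close> and
      \<open>y\<close>: inside the old one, and free of \<open>b\<close> because \<open>y\<close> is
      the first \<open>b\<close> beyond \<open>t\<close>.\<close>
    have avoid: "w ! (z - 1) \<notin> insert b L" if z: "z \<in> {1..length w}" "dlt e y z" "dlt e z t" for z
    proof -
      have "dlt f z g" if "base (h # s) = Some q" "rpos w (\<not> f) q g" for q g
        using tight_y[OF that] dlt_trans[of f z y g] z f by simp
      then have "w ! (z - 1) \<notin> L" using L(4)[OF z(1)] z(3) f by simp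
      moreover have "w ! (z - 1) \<noteq> b"
        using y[unfolded h rpos_Cons] z t(1) beyond_rpos[OF t(1)] f by (auto simp: cand_def)
      ultimately show ?thesis by simp
    qed
    have b: "base ((e, c) # h # s) = Some s" using False h by simp
    have t': "rpos w (\<not> e) s t" using t(1) f by simp
    have "c \<notin> insert b L" using avoid[OF x(1,3) tight_x[OF b t']] x(2) by simp
    then show ?thesis
      using L(1-3) avoid False h b t' by (intro exI[of _ "insert b L"]) auto
  qed
qed

lemma tight_alt:
  fixes r :: "'a::finite ranker"
  assumes "tight w r" "rpos w d r x"
  shows "alt r \<le> card (UNIV :: 'a set)"
proof (cases r)
  case (Cons h s)
  obtain e c where h: "h = (e, c)" by (cases h)
  obtain y where y: "rpos w e s y" using assms(2) unfolding Cons h by (rule rpos_ConsD)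
  obtain L where "finite L" "Suc (card L) = alt r" "c \<notin> L"
    using tight_avoids_letters[OF assms[unfolded Cons h] y] Cons h by blast
  then have "alt r = card (insert c L)" by simp
  also have "\<dots> \<le> card (UNIV :: 'a set)" by (rule card_mono) auto
  finally show ?thesis .
qed simp

text \<open>As \<open>y\<close> lies beyond \<open>t\<close> in direction \<open>e\<close>, every
  candidate found from \<open>q\<close> is also one found from \<open>s\<close>. So an
  \<open>x\<close> past \<open>y\<close> is still the nearest \<open>c\<close> when starting from
  \<open>q\<close>; if \<open>x = y\<close>, already \<open>q\<close> gets there.\<close>

lemma shortcut:
  assumes "tight w s" and b: "base ((e, c) # s) = Some q"
    and x: "rpos w d ((e, c) # s) x" and y: "rpos w (\<not> e) q y" and esc: "\<not> dlt e x y"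
  shows "rpos w d' ((e, c) # s) = rpos w d' (if x = y then q else (e, c) # q)"
proof -
  have x': "rpos w d' ((e, c) # s) x" for d'
    using x rpos_dir by (metis list.distinct(1))
  from x obtain t where t: "rpos w e s t" "dlt e t x" and xw: "x \<in> {1..length w}" "w ! (x - 1) = c"
    by (rule rpos_ConsD)
  obtain f a s' where s: "s = (f, a) # s'" using b by (cases s) auto
  \<comment> \<open>Inside a run this is tightness of \<open>s\<close>; right after the turn, it
    holds because the move from \<open>q\<close> to \<open>t\<close> went the opposite way.\<close>
  have ty: "dlt e t y"
  proof (cases "e = f")
    case True
    moreover have "rpos w (\<not> e) s t" using t(1) rpos_dir s by (metis list.distinct(1))
    ultimately show ?thesis using assms(1) b y s by simp
  next
    case False
    then have f: "f = (\<not> e)" and q: "q = s'" using b s by auto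
    from t(1) obtain y' where "rpos w f s' y'" "dlt f y' t" unfolding s by (rule rpos_ConsD)
    then show ?thesis using rpos_unique[of w f s' y' y] y f q by simp
  qed
  \<comment> \<open>An empty base denotes the end of the word towards which the ranker moves, and no
    position of the word escapes that.\<close>
  have "q \<noteq> []" using y esc xw by (auto simp: dlt_def split: if_splits)
  then have y': "rpos w d' q y" for d'
    using y rpos_dir by metis
  show ?thesis
  proof (cases "x = y")
    case True
    then show ?thesis using rpos_eqI[OF x' y'[folded True]] by simp
  next
    case False
    then have yx: "dlt e y x" using esc dlt_linear by blast
    have "cand w e c q x" using xw yx beyond_rpos[OF y'] by (simp add: cand_def)
    moreover have "\<not> dlt e z x" if "cand w e c q z" for z
    proof -
      have "dlt e y z" using that beyond_rpos[OF y'] by (simp add: cand_def)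
      with ty have "dlt e t z" by (rule dlt_trans)
      then have "cand w e c s z" using that beyond_rpos[OF t(1)] by (simp add: cand_def)
      then show ?thesis using x by (simp add: rpos_Cons)
    qed
    ultimately have "rpos w d' ((e, c) # q) x" by (simp add: rpos_Cons)
    then show ?thesis using False rpos_eqI[OF x'] by simp
  qed
qed

text \<open>Strong induction on length. Making the prefix tight first leaves it at most
  \<open>|\<Sigma>|\<close> runs, so one further move stays within the assumed equivalence. This
  settles definedness and the order against the base alike in \<open>u\<close> and \<open>v\<close>,
  hence the same shortcut is valid in both words.\<close>

lemma ranker_reduce:
  fixes u v :: "'a::finite list"
  assumes E: "fo2_alt_equiv (card (UNIV :: 'a set) + 1) n u v"
    and "length r \<le> n"
  shows "((\<exists>p. rpos u d r p) \<longleftrightarrow> (\<exists>p. rpos v d r p)) \<and>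
    ((\<exists>p. rpos u d r p) \<longrightarrow>
      (\<exists>r'. length r' \<le> length r \<and> tight u r' \<and> tight v r' \<and>
         (\<forall>d. rpos u d r' = rpos u d r \<and> rpos v d r' = rpos v d r)))"
  using assms(2)
proof (induction r arbitrary: d rule: length_induct)
  case (1 r)
  show ?case
  proof (cases r)
    case Nil
    then show ?thesis by (auto intro!: exI[of _ "[]"])
  next
    case (Cons h s)
    obtain e c where h: "h = (e, c)" by (cases h)
    have IHs: "((\<exists>p. rpos u e s p) \<longleftrightarrow> (\<exists>p. rpos v e s p)) \<and>
      ((\<exists>p. rpos u e s p) \<longrightarrow>
        (\<exists>r'. length r' \<le> length s \<and> tight u r' \<and> tight v r' \<and>
           (\<forall>d. rpos u d r' = rpos u d s \<and> rpos v d r' = rpos v d s)))"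
      using 1 Cons by simp
    show ?thesis
    proof (cases "\<exists>p. rpos u e s p")
      case False
      then have "\<not> (\<exists>p. rpos u d r p)" "\<not> (\<exists>p. rpos v d r p)"
        using IHs unfolding Cons h rpos_Cons_ex by (auto simp: cand_def beyond_def)
      then show ?thesis by blast
    next
      case True
      then obtain s' where s': "length s' \<le> length s" "tight u s'" "tight v s'"
        "\<And>d. rpos u d s' = rpos u d s" "\<And>d. rpos v d s' = rpos v d s"
        using IHs by blast
      obtain t t' where t: "rpos u e s' t" "rpos v e s' t'" using True IHs s' by auto
      let ?r = "(e, c) # s'"
      have r: "rpos u d ?r = rpos u d r" "rpos v d ?r = rpos v d r" for d
        unfolding Cons h by (rule rpos_Cons_cong, rule s')+
      have alt_s: "alt s' \<le> card (UNIV :: 'a set)" by (rule tight_alt[OF s'(2) t(1)])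
      then have alt_r: "alt ?r \<le> card (UNIV :: 'a set) + 1" by (auto simp: alt_Cons)
      have len: "length s' < n" "length ?r \<le> n" using s'(1) 1(2) Cons by auto
      have defd: "(\<exists>p. rpos u d r p) \<longleftrightarrow> (\<exists>p. rpos v d r p)" for d
        using alt_equiv_defined[OF E len(1) alt_r t] r by simp
      have "\<exists>r'. length r' \<le> length r \<and> tight u r' \<and> tight v r' \<and>
          (\<forall>d. rpos u d r' = rpos u d r \<and> rpos v d r' = rpos v d r)" if r_def: "\<exists>p. rpos u d r p"
      proof (cases "tight u ?r \<and> tight v ?r")
        case True
        then show ?thesis using r s'(1) Cons by (intro exI[of _ ?r]) auto
      next
        case False
        obtain x x' where x: "rpos u d ?r x" "rpos v d ?r x'" using r_def defd[of d] r by auto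
        have xd: "rpos u d1 ?r x" "rpos v d1 ?r x'" for d1
          using x rpos_dir by (metis list.distinct(1))+
        obtain q where q: "base ?r = Some q" using False s' by auto
        obtain y y' where y: "rpos u (\<not> e) q y" "rpos v (\<not> e) q y'"
          using base_defined[OF q x(1)] base_defined[OF q x(2)] by blast
        have "length q < length s'" "alt q \<le> alt s'"
          using base_length[OF q] base_alt[OF q] .
        then have "same_order u v ?r q"
          using alt_s len by (intro alt_equiv_same_order[OF E len(2) alt_r]) auto
        from same_orderD[OF this x y] have ord: "\<And>e. dlt e x y = dlt e x' y'" .
        have eq: "x = y \<longleftrightarrow> x' = y'"
          using ord[of True] ord[of False] by (auto simp: dlt_def)
        have esc: "\<not> dlt e x y"
        proof
          assume a: "dlt e x y"
          have "x1 = x" "y1 = y" if "rpos u (\<not> e) ?r x1" "rpos u (\<not> e) q y1" for x1 y1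
            using that xd y rpos_unique by metis+
          then have "tight u ?r" using a s'(2) q by auto
          moreover have "x1 = x'" "y1 = y'" if "rpos v (\<not> e) ?r x1" "rpos v (\<not> e) q y1" for x1 y1
            using that xd y rpos_unique by metis+
          then have "tight v ?r" using a ord s'(3) q by auto
          ultimately show False using False by blast
        qed
        let ?s = "if x = y then q else (e, c) # q"
        have S: "rpos u d1 r = rpos u d1 ?s" "rpos v d1 r = rpos v d1 ?s" for d1
          using shortcut[OF s'(2) q x(1) y(1) esc, of d1]
            shortcut[OF s'(3) q x(2) y(2), of d1] esc ord[of e] eq r by auto
        have "length ?s < length r" using \<open>length q < length s'\<close> s'(1) Cons by auto
        moreover have "\<exists>p. rpos u d ?s p" using r_def S by simp
        ultimately obtain r' where "length r' \<le> length ?s" "tight u r'" "tight v r'"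
          "\<forall>d. rpos u d r' = rpos u d ?s \<and> rpos v d r' = rpos v d ?s"
          using 1(1)[rule_format, of ?s d] 1(2) by auto
        then show ?thesis using S \<open>length ?s < length r\<close> by (intro exI[of _ r']) auto
      qed
      then show ?thesis using defd by blast
    qed
  qed
qed


section \<open>The two-pebble game\<close>

definition rankers_agree :: "nat \<Rightarrow> 'a list \<Rightarrow> 'a list \<Rightarrow> bool" where
  "rankers_agree n u v \<longleftrightarrow>
     (\<forall>r d. length r \<le> n \<longrightarrow> ((\<exists>p. rpos u d r p) \<longleftrightarrow> (\<exists>p. rpos v d r p))) \<and>
     (\<forall>r r'. length r \<le> n \<longrightarrow> length r' < n \<longrightarrow> same_order u v r r')"

lemma rankers_agree_swap: "rankers_agree n u v \<Longrightarrow> rankers_agree n v u"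
  unfolding rankers_agree_def by (blast intro: same_order_swap)

lemma rankers_agree_Suc: "rankers_agree (Suc n) u v \<Longrightarrow> rankers_agree n u v"
  unfolding rankers_agree_def by simp

lemma alt_equiv_rankers_agree:
  fixes u v :: "'a::finite list"
  assumes E: "fo2_alt_equiv (card (UNIV :: 'a set) + 1) n u v"
  shows "rankers_agree n u v"
  unfolding rankers_agree_def
proof (intro conjI allI impI)
  fix r :: "'a ranker" and d
  assume "length r \<le> n"
  then show "(\<exists>p. rpos u d r p) \<longleftrightarrow> (\<exists>p. rpos v d r p)"
    using ranker_reduce[OF E] by blast
next
  fix r r' :: "'a ranker"
  assume len: "length r \<le> n" "length r' < n"
  show "same_order u v r r'"
    unfolding same_order_def
  proof (intro allI impI)
    fix d d' p p' q q' e
    assume A: "rpos u d r p" "rpos v d r p'" "rpos u d' r' q" "rpos v d' r' q'"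
    obtain s where s: "length s \<le> length r" "tight u s"
      "\<And>d. rpos u d s = rpos u d r" "\<And>d. rpos v d s = rpos v d r"
      using ranker_reduce[OF E len(1), of d] A(1) by blast
    obtain s' where s': "length s' \<le> length r'" "tight u s'"
      "\<And>d. rpos u d s' = rpos u d r'" "\<And>d. rpos v d s' = rpos v d r'"
      using ranker_reduce[OF E, of r' d'] len(2) A(3) by auto
    have "alt s \<le> card (UNIV :: 'a set)" "alt s' \<le> card (UNIV :: 'a set)"
      using tight_alt[OF s(2)] tight_alt[OF s'(2)] A s s' by auto
    then have "same_order u v s s'"
      using len s s' by (intro alt_equiv_same_order[OF E]) auto
    then show "dlt e p q = dlt e p' q'"
      using A s s' by (intro same_orderD[of u v s s' d _ _ d']) auto
  qed
qed

definition sim :: "nat \<Rightarrow> 'a list \<Rightarrow> 'a list \<Rightarrow> nat \<Rightarrow> nat \<Rightarrow> bool" where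
  "sim n u v i i' \<longleftrightarrow>
     (i \<in> {1..length u} \<longleftrightarrow> i' \<in> {1..length v}) \<and>
     (i \<in> {1..length u} \<longrightarrow> u ! (i - 1) = v ! (i' - 1)) \<and>
     (\<forall>r d p p' e. length r \<le> n \<longrightarrow> rpos u d r p \<longrightarrow> rpos v d r p' \<longrightarrow> dlt e p i = dlt e p' i')"

lemma sim_swap: "sim n u v i i' \<Longrightarrow> sim n v u i' i"
  unfolding sim_def by metis

lemma sim_Suc: "sim (Suc n) u v i i' \<Longrightarrow> sim n u v i i'"
  unfolding sim_def by (meson le_SucI)

lemma simD:
  assumes "sim n u v i i'" "length r \<le> n" "rpos u d r p" "rpos v d r p'"
  shows "dlt e p i = dlt e p' i'"
  using assms unfolding sim_def by blast

text \<open>If a ranker of length at most \<open>n\<close> reaches \<open>j\<close>, the same ranker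
  answers in \<open>v\<close>. Otherwise take the nearest ranker positions on both sides of
  \<open>j\<close>: any position of \<open>v\<close> between their counterparts that carries the
  letter of \<open>j\<close> will do. One more move from one of the two finds such a position on the
  correct side of \<open>i'\<close>.\<close>

lemma duplicator_response:
  assumes G: "rankers_agree (Suc n) u v" and sim: "sim (Suc n) u v i i'"
    and j: "j \<in> {1..length u}"
  shows "\<exists>j'\<in>{1..length v}. sim n u v j j' \<and> (\<forall>e. dlt e i j = dlt e i' j')"
proof (cases "i = j")
  case True
  then show ?thesis using sim j sim_Suc[OF sim] by (auto simp: sim_def)
next
  case False
  then obtain e where ij: "dlt e i j" using dlt_linear[of True i j] dlt_not[of True] by metis
  define a where "a = u ! (j - 1)"
  have defd: "\<exists>p'. rpos v d r p'" if "length r \<le> Suc n" "rpos u d r p" for r d p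
    using G that unfolding rankers_agree_def by blast
  have ord: "dlt f p q = dlt f p' q'" if "length r \<le> Suc n" "length r' \<le> n"
    "rpos u d r p" "rpos v d r p'" "rpos u d' r' q" "rpos v d' r' q'" for f d d' r r' p p' q q'
    using G that same_orderD[of u v r r' d p p' d' q q'] unfolding rankers_agree_def by simp
  have dirs: "\<forall>f. dlt f i j = dlt f i' j'" if "dlt e i' j'" for j'
    using that ij by (auto simp: dlt_def split: if_splits)
  show ?thesis
  proof (cases "\<exists>r d. length r \<le> n \<and> rpos u d r j")
    case True
    then obtain r d where r: "length r \<le> n" "rpos u d r j" by blast
    obtain j' where j': "rpos v d r j'" using defd r by fastforce
    obtain h s where hs: "r = h # s" using r j by (cases r) (auto split: if_splits)
    have j'v: "j' \<in> {1..length v}" "u ! (j - 1) = v ! (j' - 1)"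
      using r(2) j' unfolding hs by (cases h; auto simp: rpos_Cons cand_def)+
    have "sim n u v j j'"
      unfolding sim_def using j'v j ord[OF le_SucI r(1) _ _ r(2) j'] by blast
    moreover have "dlt e i' j'"
      using simD[OF sim _ r(2) j', of "\<not> e"] r(1) ij by simp
    ultimately show ?thesis using j'v dirs by blast
  next
    case nor: False
    define A where "A = {p. \<exists>r d. length r \<le> n \<and> rpos u d r p}"
    have fin: "finite A"
      by (rule finite_subset[of _ "{..Suc (length u)}"]) (auto simp: A_def dest: rpos_bound)
    \<comment> \<open>The empty ranker supplies a position outside the word at either end, so
      \<open>j\<close> has ranker positions on both sides.\<close>
    have ends: "(if d then 0 else Suc (length u)) \<in> A" for d
      unfolding A_def by (rule CollectI, rule exI[of _ "[]"], rule exI[of _ d]) simp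
    have nearest: "\<exists>p\<in>A. dlt d p j \<and> (\<forall>q\<in>A. dlt d q j \<longrightarrow> \<not> dlt d p q)" for d
    proof -
      have "(if d then 0 else Suc (length u)) \<in> {p \<in> A. dlt d p j}"
        using ends[of d] j by (auto simp: dlt_def)
      then have ne: "{p \<in> A. dlt d p j} \<noteq> {}" by blast
      have "finite {p \<in> A. dlt d p j}" using fin by simp
      from finite_has_nearest[OF this ne, of "\<not> d"] obtain p where "p \<in> {p \<in> A. dlt d p j}"
        "\<And>q. q \<in> {p \<in> A. dlt d p j} \<Longrightarrow> \<not> dlt (\<not> d) q p"
        by blast
      then show ?thesis by auto
    qed
    obtain p1 where p1: "p1 \<in> A" "dlt e p1 j" "\<And>q. q \<in> A \<Longrightarrow> dlt e q j \<Longrightarrow> \<not> dlt e p1 q"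
      using nearest[of e] by blast
    obtain p2 where p2: "p2 \<in> A" "dlt e j p2" "\<And>q. q \<in> A \<Longrightarrow> dlt e j q \<Longrightarrow> \<not> dlt e q p2"
      using nearest[of "\<not> e"] by auto
    obtain r1 d1 where r1: "length r1 \<le> n" "rpos u d1 r1 p1" using p1(1) A_def by auto
    obtain r2 d2 where r2: "length r2 \<le> n" "rpos u d2 r2 p2" using p2(1) A_def by auto
    have dir1: "rpos u e r1 p1"
    proof (cases "r1 = []")
      case True
      then show ?thesis using r1(2) p1(2) j by (auto simp: dlt_def split: if_splits)
    qed (use r1 rpos_dir in metis)
    have dir2: "rpos u (\<not> e) r2 p2"
    proof (cases "r2 = []")
      case True
      then show ?thesis using r2(2) p2(2) j by (auto simp: dlt_def split: if_splits)
    qed (use r2 rpos_dir in metis)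
    obtain p1' where p1': "rpos v e r1 p1'" using defd dir1 r1(1) by fastforce
    obtain p2' where p2': "rpos v (\<not> e) r2 p2'" using defd dir2 r2(1) by fastforce
    have between: "sim n u v j j'"
      if j': "j' \<in> {1..length v}" "v ! (j' - 1) = a" "dlt e p1' j'" "dlt e j' p2'" for j'
      unfolding sim_def
    proof (intro conjI allI impI)
      fix r d p p' f
      assume r: "length r \<le> n" "rpos u d r p" "rpos v d r p'"
      have pA: "p \<in> A" using r A_def by auto
      have "p \<noteq> j" using nor r by blast
      then consider "dlt e p j" | "dlt e j p" using dlt_linear by blast
      then show "dlt f p j = dlt f p' j'"
      proof cases
        case 1
        have "\<not> dlt e p1' p'"
          using p1(3)[OF pA 1] ord[OF _ r(1) dir1 p1' r(2,3)] r1(1) by simp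
        then have "dlt e p' j'" using j'(3) dlt_le_trans by blast
        then show ?thesis using 1 by (auto simp: dlt_def split: if_splits)
      next
        case 2
        have "\<not> dlt e p' p2'"
          using p2(3)[OF pA 2] ord[OF _ r2(1) r(2,3) dir2 p2'] r(1) by simp
        then have "dlt e j' p'" using j'(4) dlt_trans_le by blast
        then show ?thesis using 2 by (auto simp: dlt_def split: if_splits)
      qed
    qed (use j j' a_def in auto)
    show ?thesis
    proof (cases "dlt e p1 i")
      \<comment> \<open>As \<open>p1\<close> does not precede \<open>i\<close> in direction
        \<open>e\<close>, the first \<open>a\<close> beyond \<open>p1'\<close> lies beyond
        \<open>i'\<close>.\<close>
      case False
      have "cand u e a r1 j" using j a_def p1(2) beyond_rpos[OF dir1] by (simp add: cand_def)
      from cand_rpos[OF this] obtain t where t: "rpos u e ((e, a) # r1) t" "\<not> dlt e j t" by blast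
      obtain t' where t': "rpos v e ((e, a) # r1) t'" using defd t(1) r1(1) by fastforce
      from t' have t'v: "t' \<in> {1..length v}" "v ! (t' - 1) = a" "dlt e p1' t'"
        using rpos_unique[OF p1'] by (auto elim!: rpos_ConsD)
      have "dlt e t p2" using t(2) p2(2) dlt_le_trans by blast
      then have "dlt e t' p2'" using ord[OF _ r2(1) t(1) t' dir2 p2'] r1(1) by simp
      moreover have "dlt e i' t'"
      proof -
        have "\<not> dlt e p1' i'" using False simD[OF sim _ dir1 p1'] r1(1) by simp
        then show ?thesis using t'v(3) dlt_le_trans by blast
      qed
      ultimately show ?thesis using between t'v dirs by blast
    next
      \<comment> \<open>A move from \<open>p1\<close> could stop before passing \<open>i\<close>.
        The first \<open>a\<close> met going back from \<open>p2\<close> is not before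
        \<open>j\<close>, hence beyond \<open>i\<close>, and \<open>sim (Suc n)\<close> carries this
        over to \<open>v\<close>.\<close>
      case True
      have "cand u (\<not> e) a r2 j" using j a_def p2(2) beyond_rpos[OF dir2] by (simp add: cand_def)
      from cand_rpos[OF this] obtain t
        where t: "rpos u e ((\<not> e, a) # r2) t" "\<not> dlt e t j" by auto
      obtain t' where t': "rpos v e ((\<not> e, a) # r2) t'" using defd t(1) r2(1) by fastforce
      from t' have t'v: "t' \<in> {1..length v}" "v ! (t' - 1) = a" "dlt e t' p2'"
        using rpos_unique[OF p2'] by (auto elim!: rpos_ConsD)
      have "dlt e p1 t" using t(2) p1(2) dlt_trans_le by blast
      then have "dlt e p1' t'" using ord[OF _ r1(1) t(1) t' dir1 p1', of "\<not> e"] r2(1) by simp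
      moreover have "dlt e i t" using t(2) ij dlt_trans_le by blast
      then have "dlt e i' t'" using simD[OF sim _ t(1) t', of "\<not> e"] r2(1) by simp
      ultimately show ?thesis using between t'v dirs by blast
    qed
  qed
qed

section \<open>From the game to formulas\<close>

lemma other_var: "z' \<noteq> z \<Longrightarrow> z' = other z"
  by (cases z; cases z') auto

definition pebbles :: "nat \<Rightarrow> 'a list \<Rightarrow> 'a list \<Rightarrow> (var \<Rightarrow> nat) \<Rightarrow> (var \<Rightarrow> nat) \<Rightarrow> bool" where
  "pebbles n u v s t \<longleftrightarrow>
     (\<forall>z. sim n u v (s z) (t z)) \<and> (\<forall>z z' e. dlt e (s z) (s z') = dlt e (t z) (t z'))"

lemma pebbles_swap: "pebbles n u v s t \<Longrightarrow> pebbles n v u t s"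
  unfolding pebbles_def by (blast intro: sim_swap)

text \<open>With two variables the old place of the moved pebble is forgotten, so the answer only
  has to respect the pebble that stays.\<close>

lemma pebbles_move:
  assumes G: "rankers_agree (Suc n) u v" and P: "pebbles (Suc n) u v s t"
    and j: "j \<in> {1..length u}"
  shows "\<exists>j'\<in>{1..length v}. pebbles n u v (s(z := j)) (t(z := j'))"
proof -
  have "sim (Suc n) u v (s (other z)) (t (other z))" using P by (simp add: pebbles_def)
  from duplicator_response[OF G this j] obtain j' where j': "j' \<in> {1..length v}" "sim n u v j j'"
    "\<And>e. dlt e (s (other z)) j = dlt e (t (other z)) j'" by blast
  have "dlt e j (s (other z)) = dlt e j' (t (other z))" for e
    using j'(3)[of "\<not> e"] by simp
  then have "pebbles n u v (s(z := j)) (t(z := j'))"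
    using P j' unfolding pebbles_def by (auto intro: sim_Suc dest!: other_var)
  then show ?thesis using j'(1) by blast
qed

text \<open>Variables that are not free may be assigned the position \<open>0\<close> outside the word: this is how
  unplaced pebbles are represented.\<close>

lemma pebbles_sat:
  assumes "rankers_agree n u v" "pebbles n u v s t" "qdepth \<phi> \<le> n"
    and "\<And>z. z \<in> free \<phi> \<Longrightarrow> s z \<in> {1..length u}"
  shows "sat u s \<phi> \<longleftrightarrow> sat v t \<phi>"
  using assms
proof (induction \<phi> arbitrary: n s t)
  case (Q a z)
  then show ?case by (auto simp: pebbles_def sim_def)
next
  case (Less z z')
  have "dlt True (s z) (s z') = dlt True (t z) (t z')" using Less(2) unfolding pebbles_def by blast
  then show ?case by (simp add: dlt_def)
next
  case (Neg \<phi>)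
  then show ?case by auto
next
  case (Conj \<phi> \<psi>)
  then show ?case by auto
next
  case (Disj \<phi> \<psi>)
  then show ?case by auto
next
  case (Ex z \<phi>)
  obtain m where n: "n = Suc m" using Ex.prems(3) by (cases n) auto
  have IH: "sat u (s(z := j)) \<phi> \<longleftrightarrow> sat v (t(z := j')) \<phi>"
    if "pebbles m u v (s(z := j)) (t(z := j'))" "j \<in> {1..length u}" for j j'
    using that Ex.prems n
    by (intro Ex.IH[OF rankers_agree_Suc that(1)]) auto
  have fwd: "\<exists>j'\<in>{1..length v}. pebbles m u v (s(z := j)) (t(z := j'))"
    if "j \<in> {1..length u}" for j
    using pebbles_move[OF _ _ that] Ex.prems(1,2) n by blast
  have bwd: "\<exists>j\<in>{1..length u}. pebbles m u v (s(z := j)) (t(z := j'))"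
    if "j' \<in> {1..length v}" for j'
    using pebbles_move[OF rankers_agree_swap pebbles_swap that] Ex.prems(1,2) n pebbles_swap by blast
  show ?case unfolding sat.simps using IH fwd bwd by meson
next
  case (All z \<phi>)
  obtain m where n: "n = Suc m" using All.prems(3) by (cases n) auto
  have IH: "sat u (s(z := j)) \<phi> \<longleftrightarrow> sat v (t(z := j')) \<phi>"
    if "pebbles m u v (s(z := j)) (t(z := j'))" "j \<in> {1..length u}" for j j'
    using that All.prems n
    by (intro All.IH[OF rankers_agree_Suc that(1)]) auto
  have fwd: "\<exists>j'\<in>{1..length v}. pebbles m u v (s(z := j)) (t(z := j'))"
    if "j \<in> {1..length u}" for j
    using pebbles_move[OF _ _ that] All.prems(1,2) n by blast
  have bwd: "\<exists>j\<in>{1..length u}. pebbles m u v (s(z := j)) (t(z := j'))"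
    if "j' \<in> {1..length v}" for j'
    using pebbles_move[OF rankers_agree_swap pebbles_swap that] All.prems(1,2) n pebbles_swap by blast
  show ?case unfolding sat.simps using IH fwd bwd by meson
qed simp_all

lemma sat_free_cong: "(\<And>z. z \<in> free \<phi> \<Longrightarrow> s z = t z) \<Longrightarrow> sat w s \<phi> \<longleftrightarrow> sat w t \<phi>"
proof (induction \<phi> arbitrary: s t)
  case (Ex z \<phi>)
  then have "sat w (s(z := i)) \<phi> \<longleftrightarrow> sat w (t(z := i)) \<phi>" for i by (intro Ex.IH) auto
  then show ?case by simp
next
  case (All z \<phi>)
  then have "sat w (s(z := i)) \<phi> \<longleftrightarrow> sat w (t(z := i)) \<phi>" for i by (intro All.IH) auto
  then show ?case by simp
next
  case (Conj \<phi> \<psi>)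
  have "sat w s \<phi> \<longleftrightarrow> sat w t \<phi>" "sat w s \<psi> \<longleftrightarrow> sat w t \<psi>"
    by (rule Conj.IH, simp add: Conj.prems)+
  then show ?case by simp
next
  case (Disj \<phi> \<psi>)
  have "sat w s \<phi> \<longleftrightarrow> sat w t \<phi>" "sat w s \<psi> \<longleftrightarrow> sat w t \<psi>"
    by (rule Disj.IH, simp add: Disj.prems)+
  then show ?case by simp
next
  case (Neg \<phi>)
  have "sat w s \<phi> \<longleftrightarrow> sat w t \<phi>" by (rule Neg.IH) (simp add: Neg.prems)
  then show ?case by simp
qed simp_all

text \<open>A ranker sits at \<open>0\<close> only if it is empty and read to the right, which does
  not depend on the word.\<close>

lemma pebbles_initial: "pebbles n u v (\<lambda>_. 0) (\<lambda>_. 0)"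
proof -
  have "dlt e p 0 = dlt e p' 0" if "rpos u d r p" "rpos v d r p'" for r d p p' e
    using that by (cases r) (auto simp: rpos_Cons cand_def dlt_def split: if_splits)
  then show ?thesis by (auto simp: pebbles_def sim_def)
qed

theorem theorem4p7:
  fixes u v :: "'a::finite list" and n :: nat
  assumes "fo2_alt_equiv (card (UNIV :: 'a set) + 1) n u v"
  shows "fo2_equiv n u v"
  unfolding fo2_equiv_def
proof (intro allI impI)
  fix \<phi> :: "'a fo2"
  assume \<phi>: "sentence \<phi> \<and> qdepth \<phi> \<le> n"
  \<comment> \<open>\<open>models\<close> starts from \<open>1\<close>, the game from unplaced
    pebbles at \<open>0\<close>; a sentence cannot tell these apart.\<close>
  have "models w \<phi> \<longleftrightarrow> sat w (\<lambda>_. 0) \<phi>" for w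
    unfolding models_def using \<phi> by (intro sat_free_cong) (simp add: sentence_def)
  moreover have "sat u (\<lambda>_. 0) \<phi> \<longleftrightarrow> sat v (\<lambda>_. 0) \<phi>"
    using \<phi> by (intro pebbles_sat[OF alt_equiv_rankers_agree[OF assms] pebbles_initial])
      (auto simp: sentence_def)
  ultimately show "models u \<phi> \<longleftrightarrow> models v \<phi>" by simp
qed

end
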